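(* There is an absolute constant $C>0$ such that for arbitrarily large positive integers $N$ there exist a non-periodic tiling $\mathbb{Z}_N=A\oplus B$ and additional distinct non-periodic tiling complements $B_1,\dots,B_k$ of $A$ in $\mathbb{Z}_N$ (that is, pairwise distinct non-periodic sets, all different from $B$, with $\mathbb{Z}_N=A\oplus B_i$ for each $i$), where $k\ge e^{C\sqrt{N}}$.
   Context: $\mathbb{Z}_N=\mathbb{Z}/N\mathbb{Z}$. For subsets $A,B$ of an abelian group $G$, $G=A\oplus B$ means that every $g\in G$ has a unique representation $g=a+b$ with $a\in A$, $b\in B$; then $A$ and $B$ are called tiling complements of each other and $G = A\oplus B$ is called a tiling. A set $B\subseteq G$ is periodic if there is a nonzero $g\in G$ with $B+g=B$, and non-periodic otherwise. A tiling $G=A\oplus B$ is non-periodic if neither $A$ nor $B$ is periodic. *)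

theory Defs
  imports Complex_Main "HOL-Algebra.Elementary_Groups"
begin

text \<open>
  Groups are HOL-Algebra groups, hence written multiplicatively: \<open>a \<otimes> b\<close> is the sum
  $a + b$, \<open>\<one>\<close> is $0$, and the right coset \<open>B #> g\<close> is the translate $B + g$.
  The cyclic group $\mathbb{Z}_N$ is \<open>integer_mod_group N\<close>, with carrier \<open>{0..<int N}\<close>
  for \<open>N > 0\<close> (for \<open>N = 0\<close> it is the infinite group of integers).
\<close>

definition tiling :: "('a, 'b) monoid_scheme \<Rightarrow> 'a set \<Rightarrow> 'a set \<Rightarrow> bool" where
  "tiling G A B \<longleftrightarrow> A \<subseteq> carrier G \<and> B \<subseteq> carrier G \<and>
     (\<forall>g \<in> carrier G. \<exists>!p. p \<in> A \<times> B \<and> g = fst p \<otimes>\<^bsub>G\<^esub> snd p)"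

definition periodic :: "('a, 'b) monoid_scheme \<Rightarrow> 'a set \<Rightarrow> bool" where
  "periodic G B \<longleftrightarrow> (\<exists>g \<in> carrier G. g \<noteq> \<one>\<^bsub>G\<^esub> \<and> B #>\<^bsub>G\<^esub> g = B)"

definition nonperiodic_tiling :: "('a, 'b) monoid_scheme \<Rightarrow> 'a set \<Rightarrow> 'a set \<Rightarrow> bool" where
  "nonperiodic_tiling G A B \<longleftrightarrow> tiling G A B \<and> \<not> periodic G A \<and> \<not> periodic G B"

end

theory Submission
  imports Defs "HOL-Number_Theory.Cong"
begin

text \<open>
  Let \<open>m = 2h + 1\<close> and \<open>N = 24 m\<close>, so that $\mathbb{Z}_N \cong \mathbb{Z}_8 \times \mathbb{Z}_{3m}$.
  The box \<open>A = {0, 2} \<times> {0, 1, 2}\<close> lies in the subgroup of even elements, so the two parts of a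
  complement, in the even and in the odd coset, may be chosen independently. In either coset one may
  start from the lattice complement of the box and slide rows or columns (Vuza's construction). In
  the even coset each of the \<open>m\<close> rows \<open>{4 i} \<times> {3 j}\<close> is slid by 0 or 2, according to a set \<open>S\<close> of
  indices \<open>j\<close> modulo \<open>m\<close>; the periods of this part in the second direction are those of \<open>S\<close>.
  In the odd coset one of the two columns is slid by 1, which destroys the periods in the first
  direction. If \<open>0 \<in> S \<subseteq> {0} \<union> {h<..<m}\<close>, then \<open>S\<close> has no period modulo \<open>m\<close>, because
  \<open>d\<close> and \<open>m - d\<close> cannot both exceed \<open>h\<close>. There are \<open>2 ^ h\<close> such sets \<open>S\<close>, which is even
  exponential in \<open>N\<close>.
\<close>

subsection \<open>Subsets of a cyclic group given by periodic predicates\<close>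

definition residues_of :: "nat \<Rightarrow> (int \<Rightarrow> bool) \<Rightarrow> int set" where
  "residues_of N P = {x \<in> {0..<int N}. P x}"

text \<open>Predicates on all integers spare reductions modulo \<open>N\<close>. Uniqueness is asked
  of the first summand only, since the second is then \<open>g - a\<close>.\<close>

lemma tiling_residues_ofI:
  assumes N: "N > 0"
    and P: "\<And>x. P (x mod int N) = P x" and Q: "\<And>x. Q (x mod int N) = Q x"
    and ex: "\<And>g. \<exists>a. P a \<and> Q (g - a)"
    and uniq: "\<And>g a b. \<lbrakk>P a; Q (g - a); P b; Q (g - b)\<rbrakk> \<Longrightarrow> [a = b] (mod int N)"
  shows "tiling (integer_mod_group N) (residues_of N P) (residues_of N Q)"
  unfolding tiling_def
proof (intro conjI ballI)
  show "residues_of N P \<subseteq> carrier (integer_mod_group N)"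
    "residues_of N Q \<subseteq> carrier (integer_mod_group N)"
    using N by (auto simp: residues_of_def carrier_integer_mod_group)
next
  fix g assume "g \<in> carrier (integer_mod_group N)"
  then have g: "0 \<le> g" "g < int N" using N by (auto simp: carrier_integer_mod_group)
  obtain a where a: "P a" "Q (g - a)" using ex by blast
  show "\<exists>!p. p \<in> residues_of N P \<times> residues_of N Q
      \<and> g = fst p \<otimes>\<^bsub>integer_mod_group N\<^esub> snd p"
  proof (rule ex1I[of _ "(a mod int N, (g - a) mod int N)"])
    show "(a mod int N, (g - a) mod int N) \<in> residues_of N P \<times> residues_of N Q \<and>
      g = fst (a mod int N, (g - a) mod int N)
        \<otimes>\<^bsub>integer_mod_group N\<^esub> snd (a mod int N, (g - a) mod int N)"
      using a g N P Q by (simp add: residues_of_def mult_integer_mod_group mod_simps)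
  next
    fix p assume p: "p \<in> residues_of N P \<times> residues_of N Q
      \<and> g = fst p \<otimes>\<^bsub>integer_mod_group N\<^esub> snd p"
    obtain b c where bc: "p = (b, c)" by fastforce
    have b: "P b" "0 \<le> b" "b < int N" and c: "Q c" "0 \<le> c" "c < int N"
      and gbc: "g = (b + c) mod int N"
      using p by (auto simp: bc residues_of_def mult_integer_mod_group)
    have c_eq: "(g - b) mod int N = c" using c by (simp add: gbc mod_simps)
    then have "Q (g - b)" using Q c(1) by metis
    then have "[a = b] (mod int N)" using uniq a b(1) by blast
    then have b_eq: "a mod int N = b" using b by (simp add: cong_def)
    then have "(g - a) mod int N = c" using c_eq by (metis mod_diff_right_eq)
    then show "p = (a mod int N, (g - a) mod int N)" using b_eq bc by simp
  qed
qed

text \<open>Lifts a period of the residue set to a shift that preserves \<open>Q\<close> at every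
  integer, so that periods can be refuted by evaluating \<open>Q\<close> at convenient
  points.\<close>

lemma periodic_residues_ofE:
  assumes per: "periodic (integer_mod_group N) (residues_of N Q)"
    and N: "N > 0" and Q: "\<And>x. Q (x mod int N) = Q x"
  obtains g where "\<not> int N dvd g" "\<And>x. Q (x + g) = Q x"
proof -
  obtain g where g: "0 \<le> g" "g < int N" "g \<noteq> 0"
    and eq: "residues_of N Q #>\<^bsub>integer_mod_group N\<^esub> g = residues_of N Q"
    using per N by (auto simp: periodic_def carrier_integer_mod_group)
  have "Q (x + g) = Q x" for x
  proof
    assume "Q x"
    then have "x mod int N \<in> residues_of N Q" using N Q by (simp add: residues_of_def)
    then have "x mod int N \<otimes>\<^bsub>integer_mod_group N\<^esub> g \<in> residues_of N Q"
      using eq by (auto simp: r_coset_def)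
    then have "Q ((x + g) mod int N)"
      by (simp add: residues_of_def mult_integer_mod_group mod_simps)
    then show "Q (x + g)" using Q by simp
  next
    assume "Q (x + g)"
    then have "(x + g) mod int N \<in> residues_of N Q" using N Q by (simp add: residues_of_def)
    then obtain y where y: "y \<in> residues_of N Q" "(x + g) mod int N = (y + g) mod int N"
      using eq by (auto simp: r_coset_def mult_integer_mod_group)
    then have "x mod int N = y mod int N" by (metis add_diff_cancel_right' mod_diff_left_eq)
    then show "Q x" using y(1) Q by (metis (mono_tags, lifting) mem_Collect_eq residues_of_def)
  qed
  moreover have "\<not> int N dvd g" using g by (simp add: zdvd_not_zless)
  ultimately show thesis using that by blast
qed

subsection \<open>The tiles\<close>

definition box_pred :: "int \<Rightarrow> int \<Rightarrow> bool" where
  "box_pred m x \<longleftrightarrow> x mod 8 \<in> {0, 2} \<and> x mod (3 * m) \<in> {0, 1, 2}"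

text \<open>The first disjunct is the even part of the complement, the other two are its odd part.\<close>

definition compl_pred :: "int \<Rightarrow> int set \<Rightarrow> int \<Rightarrow> bool" where
  "compl_pred m S x \<longleftrightarrow>
     x mod 3 = 0 \<and> x mod 4 = (if x div 3 mod m \<in> S then 2 else 0) \<or>
     x mod 3 = 0 \<and> x mod 8 = 1 \<or> x mod 3 = 1 \<and> x mod 8 = 5"

lemma box_pred_mod:
  assumes "24 * m dvd n"
  shows "box_pred m (x mod n) = box_pred m x"
proof -
  have "8 dvd 24 * m" "3 * m dvd 24 * m" by (auto intro: mult_dvd_mono)
  then have "8 dvd n" "3 * m dvd n" using assms by (blast intro: dvd_trans)+
  then show ?thesis by (simp add: box_pred_def mod_mod_cancel)
qed

lemma compl_pred_add_mult:
  assumes "24 * m dvd n"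
  shows "compl_pred m S (x + n * q) = compl_pred m S x"
proof -
  obtain r where n: "n = 24 * m * r" using assms by (rule dvdE)
  have 1: "x + n * q = x + (8 * (m * r * q)) * 3" "x + n * q = x + (6 * (m * r * q)) * 4"
    "x + n * q = x + (3 * (m * r * q)) * 8"
    by (simp_all add: n)
  \<comment> \<open>The row index is the only ingredient that is not a plain residue; it moves by a
    multiple of \<open>m\<close>.\<close>
  have "(x + n * q) div 3 = x div 3 + 8 * (m * r * q)" unfolding 1(1) by simp
  also have "\<dots> = x div 3 + m * (8 * r * q)" by simp
  finally have "(x + n * q) div 3 mod m = x div 3 mod m" by (simp only: mod_mult_self2)
  moreover have "(x + n * q) mod 3 = x mod 3" unfolding 1(1) by (rule mod_mult_self1)
  moreover have "(x + n * q) mod 4 = x mod 4" unfolding 1(2) by (rule mod_mult_self1)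
  moreover have "(x + n * q) mod 8 = x mod 8" unfolding 1(3) by (rule mod_mult_self1)
  ultimately show ?thesis unfolding compl_pred_def by (simp only:)
qed

lemma compl_pred_mod:
  assumes "24 * m dvd n"
  shows "compl_pred m S (x mod n) = compl_pred m S x"
  using compl_pred_add_mult[OF assms, of S "x mod n" "x div n"] by simp

section \<open>Chinese remaindering and the tiling property\<close>

lemma odd_square_mod_8: "odd (k::int) \<Longrightarrow> k\<^sup>2 mod 8 = 1"
proof -
  assume "odd k"
  then have "k mod 8 \<in> {1, 3, 5, 7}" by auto presburger
  then have "(k mod 8)\<^sup>2 mod 8 = 1" by auto
  then show ?thesis by (simp add: power_mod)
qed

text \<open>The square of \<open>k\<close> is 0 modulo \<open>k\<close> and 1 modulo 8, so it acts
  as the idempotent in an explicit Chinese remainder solution.\<close>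

lemma ex_residues_8_odd:
  assumes "odd (k::int)"
  obtains x where "x mod 8 = a mod 8" "x mod k = b mod k"
proof
  have "(b + k\<^sup>2 * (a - b)) mod 8 = (b + k\<^sup>2 mod 8 * (a - b)) mod 8"
    by (metis mod_add_right_eq mod_mult_left_eq)
  then show "(b + k\<^sup>2 * (a - b)) mod 8 = a mod 8" using odd_square_mod_8[OF assms] by simp
  show "(b + k\<^sup>2 * (a - b)) mod k = b mod k" by (simp add: power2_eq_square mult.assoc)
qed

lemma cong_8_odd:
  assumes "odd (m::int)" "a mod 8 = b mod 8" "a mod (3 * m) = b mod (3 * m)"
  shows "[a = b] (mod 24 * m)"
proof -
  have "coprime (2 ^ 3) (3 * m)" using assms(1) by (subst coprime_power_left_iff) simp
  moreover have "2 ^ 3 dvd a - b" "3 * m dvd a - b" using assms(2,3) by (simp_all add: mod_eq_dvd_iff)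
  ultimately have "2 ^ 3 * (3 * m) dvd a - b" by (rule divides_mult[rotated 2])
  then show ?thesis by (simp add: cong_iff_dvd_diff)
qed

text \<open>For fixed \<open>g\<close> this solves for the two coordinates of \<open>a\<close>,
  which serves both existence and uniqueness. Since \<open>a\<close> is even, the parity of
  \<open>g\<close> decides which part of the complement can contain \<open>g - a\<close>.\<close>

lemma box_compl_sum_iff:
  assumes "box_pred m a" "m > 0"
  shows "compl_pred m S (g - a) \<longleftrightarrow>
    (if even g
     then a mod (3 * m) = g mod 3 \<and>
       a mod 8 = (g - (if g div 3 mod m \<in> S then 2 else 0)) mod 4
     else a mod 8 = (g - 1) mod 4 \<and>
       a mod (3 * m) = (g - (if (g - a) mod 8 = 1 then 0 else 1)) mod 3)"
proof -
  obtain v where v: "v = a mod (3 * m)" "v \<in> {0, 1, 2}" using assms by (auto simp: box_pred_def)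
  obtain u where u: "u = a mod 8" "u \<in> {0, 2}" using assms by (auto simp: box_pred_def)
  obtain q where q: "a = 3 * m * q + v" using v(1) by (metis mult_div_mod_eq)
  \<comment> \<open>The row of \<open>g - a\<close> is that of \<open>g\<close> whichever
    \<open>a\<close> is used, so \<open>S\<close> is consulted only at \<open>g\<close>.\<close>
  have row: "(g - a) div 3 mod m = g div 3 mod m" if "v = g mod 3"
  proof -
    have "g - a = 3 * (g div 3 - m * q)" using that q by (simp add: algebra_simps)
    then have "(g - a) div 3 = g div 3 - m * q" by simp
    then show ?thesis by (simp add: mod_diff_eq[symmetric])
  qed
  have mod3: "(g - a) mod 3 = (g - v) mod 3"
  proof -
    have "g - a = g - v + 3 * (- m * q)" using q by simp
    then show ?thesis by (metis mod_mult_self2)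
  qed
  have v': "v = 0 \<or> v = 1 \<or> v = 2" using v(2) by simp
  have u': "a mod 8 = 0 \<and> u = 0 \<or> a mod 8 = 2 \<and> u = 2" using u by auto
  have v3: "(g - a) mod 3 = 0 \<longleftrightarrow> v = g mod 3" "(g - a) mod 3 = 1 \<longleftrightarrow> v = (g - 1) mod 3"
  proof -
    define r where "r = g mod 3"
    have r: "r \<in> {0, 1, 2}" unfolding r_def by auto
    have "(g - v) mod 3 = (r - v) mod 3" by (simp add: r_def mod_diff_left_eq)
    moreover have "(g - 1) mod 3 = (r - 1) mod 3" by (simp add: r_def mod_diff_left_eq)
    moreover have "(r - v) mod 3 = 0 \<longleftrightarrow> v = r" "(r - v) mod 3 = 1 \<longleftrightarrow> v = (r - 1) mod 3"
      using r v' by (elim insertE emptyE disjE; simp)+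
    ultimately show "(g - a) mod 3 = 0 \<longleftrightarrow> v = g mod 3" "(g - a) mod 3 = 1 \<longleftrightarrow> v = (g - 1) mod 3"
      by (simp_all only: mod3 r_def)
  qed
  have even_a: "even a" using u' by presburger
  have par: "even (g - a) = even g" using even_a by simp
  have diff_a8: "(g - a) mod 8 = (g - u) mod 8"
    unfolding u(1) by (rule mod_diff_right_eq[symmetric])
  then have diff_a4: "(g - a) mod 4 = (g - u) mod 4"
    using mod_mod_cancel[of 4 8 "g - a"] mod_mod_cancel[of 4 8 "g - u"] by simp
  have u'': "u = 0 \<or> u = 2" using u(2) by simp
  have ev: "(g - a) mod 4 = t \<longleftrightarrow> u = (g - t) mod 4" if "even g" "t = 0 \<or> t = 2" for t
    unfolding diff_a4 using u'' that by (elim disjE) (simp_all, presburger+)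
  \<comment> \<open>The classes 1 and 5 modulo 8 together form the class 1 modulo 4, so the first
    coordinate is fixed before the column is known.\<close>
  have od: "(g - a) mod 8 = 1 \<or> (g - a) mod 8 = 5 \<longleftrightarrow> u = (g - 1) mod 4" if "odd g"
  proof -
    define w where "w = g mod 8"
    have w: "w \<in> {1, 3, 5, 7}" using that unfolding w_def by auto presburger
    have "(g - u) mod 8 = (w - u) mod 8" by (simp add: w_def mod_diff_left_eq)
    moreover have "(g - 1) mod 4 = (w - 1) mod 4"
      by (rule mod_diff_cong) (simp_all add: w_def mod_mod_cancel)
    moreover have "(w - u) mod 8 = 1 \<or> (w - u) mod 8 = 5 \<longleftrightarrow> u = (w - 1) mod 4"
      using w u'' by (elim insertE emptyE disjE; simp)
    ultimately show ?thesis by (simp only: diff_a8)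
  qed
  show ?thesis
  proof (cases "even g")
    case True
    then have "(g - a) mod 8 \<noteq> 1" "(g - a) mod 8 \<noteq> 5" using par by presburger+
    then have "compl_pred m S (g - a) \<longleftrightarrow> (g - a) mod 3 = 0 \<and>
        (g - a) mod 4 = (if (g - a) div 3 mod m \<in> S then 2 else 0)"
      unfolding compl_pred_def by blast
    also have "\<dots> \<longleftrightarrow> v = g mod 3 \<and> (g - a) mod 4 = (if g div 3 mod m \<in> S then 2 else 0)"
      by (simp only: v3(1) row cong: conj_cong)
    also have "\<dots> \<longleftrightarrow> v = g mod 3 \<and> u = (g - (if g div 3 mod m \<in> S then 2 else 0)) mod 4"
      by (subst ev[OF True]) auto
    finally show ?thesis using True by (simp only: u(1) v(1) if_True)
  next
    case False
    then have "(g - a) mod 4 \<noteq> 0" "(g - a) mod 4 \<noteq> 2" using par by presburger+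
    then show ?thesis unfolding compl_pred_def v(1)[symmetric] u(1)[symmetric]
      using False v3 od by (cases "(g - a) mod 8 = 1") (simp_all add: conj_commute)
  qed
qed

lemma tiling_box_compl:
  assumes "odd m" "m > 0"
  shows "tiling (integer_mod_group (24 * m))
    (residues_of (24 * m) (box_pred (int m))) (residues_of (24 * m) (compl_pred (int m) S))"
proof (rule tiling_residues_ofI)
  fix g :: int
  define u where
    "u = (if even g then (g - (if g div 3 mod int m \<in> S then 2 else 0)) mod 4 else (g - 1) mod 4)"
  \<comment> \<open>For odd \<open>g\<close> the column of \<open>g - a\<close> depends on the first
    coordinate, so \<open>v\<close> is computed from \<open>u\<close>.\<close>
  define v where "v = (if even g then g mod 3 else (g - (if (g - u) mod 8 = 1 then 0 else 1)) mod 3)"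
  have u: "u \<in> {0, 2}" unfolding u_def by (auto; presburger)
  have v: "v \<in> {0, 1, 2}" unfolding v_def by (auto; presburger)
  obtain a where a8: "a mod 8 = u mod 8" and am: "a mod (3 * int m) = v mod (3 * int m)"
    using ex_residues_8_odd[of "3 * int m" u v] assms by auto
  have am': "a mod (3 * int m) = v" using am v assms by (auto simp: mod_pos_pos_trivial)
  have a8': "a mod 8 = u" using a8 u by auto
  have ga: "(g - a) mod 8 = (g - u) mod 8" using a8 by (metis mod_diff_right_eq)
  have "box_pred (int m) a" using a8' am' u v by (simp add: box_pred_def)
  moreover from this have "compl_pred (int m) S (g - a)"
    using assms by (subst box_compl_sum_iff) (auto simp: a8' am' ga u_def v_def)
  ultimately show "\<exists>a. box_pred (int m) a \<and> compl_pred (int m) S (g - a)" by blast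
next
  fix g a b
  assume *: "box_pred (int m) a" "compl_pred (int m) S (g - a)"
    "box_pred (int m) b" "compl_pred (int m) S (g - b)"
  have 8: "a mod 8 = b mod 8"
    using * assms by (simp add: box_compl_sum_iff split: if_splits)
  then have "(g - a) mod 8 = (g - b) mod 8" by (metis mod_diff_right_eq)
  then have "a mod (3 * int m) = b mod (3 * int m)"
    using * assms by (simp add: box_compl_sum_iff split: if_splits)
  then show "[a = b] (mod int (24 * m))" using cong_8_odd[of "int m" a b] 8 assms by simp
qed (use assms in \<open>simp_all add: box_pred_mod compl_pred_mod\<close>)

subsection \<open>Non-periodicity\<close>

text \<open>As 0 is in the box, a period and its negative both satisfy \<open>box_pred\<close>,
  which forces both coordinates of the period to vanish.\<close>

lemma not_periodic_box:
  assumes "odd m" "m > 1"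
  shows "\<not> periodic (integer_mod_group (24 * m)) (residues_of (24 * m) (box_pred (int m)))"
proof
  assume "periodic (integer_mod_group (24 * m)) (residues_of (24 * m) (box_pred (int m)))"
  then obtain g where g: "\<not> int (24 * m) dvd g" "\<And>x. box_pred (int m) (x + g) = box_pred (int m) x"
    by (rule periodic_residues_ofE) (use assms in \<open>simp_all add: box_pred_mod\<close>)
  have "box_pred (int m) 0" by (simp add: box_pred_def)
  then have *: "box_pred (int m) g" "box_pred (int m) (- g)"
    using g(2)[of 0] g(2)[of "- g"] by auto
  have "g mod 8 = 0 \<or> g mod 8 = 2" "(- g) mod 8 = 0 \<or> (- g) mod 8 = 2"
    using * by (auto simp: box_pred_def)
  then have "g mod 8 = 0" by presburger
  moreover have "g mod (3 * int m) = 0"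
  proof (rule ccontr)
    assume nz: "g mod (3 * int m) \<noteq> 0"
    then have "(- g) mod (3 * int m) = 3 * int m - g mod (3 * int m)"
      using zmod_zminus1_eq_if by presburger
    \<comment> \<open>Two residues of at most 2 cannot add up to \<open>3 * m\<close>.\<close>
    moreover have "3 * int m > 4" using assms by simp
    ultimately show False using * nz unfolding box_pred_def by auto
  qed
  ultimately show False using cong_8_odd[of "int m" g 0] assms g(1) by (simp add: cong_0_iff)
qed

text \<open>Periods modulo 24: the odd part excludes all of them except 0, and an odd period is excluded
  because only the even part is invariant under \<open>12 m\<close>.\<close>

lemma compl_period_dvd:
  assumes m: "odd m" and per: "\<And>x. compl_pred m S (x + g) = compl_pred m S x"
  shows "24 dvd g"
proof -
  have C1: "compl_pred m S x \<longleftrightarrow> x mod 8 = 1 \<and> x mod 3 = 0 \<or> x mod 8 = 5 \<and> x mod 3 = 1"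
    if "odd x" for x
  proof -
    have "x mod 4 \<noteq> 0" "x mod 4 \<noteq> 2" using that by presburger+
    then show ?thesis by (auto simp: compl_pred_def)
  qed
  \<comment> \<open>The even part sees only residues modulo 3 and 4 and the row index modulo
    \<open>m\<close>, all unchanged by \<open>12 * m\<close>.\<close>
  have C0: "compl_pred m S (x + 12 * m) = compl_pred m S x" if "even x" for x
  proof -
    have 1: "x + 12 * m = x + (4 * m) * 3" "x + 12 * m = x + (3 * m) * 4" by simp_all
    have "(x + 12 * m) div 3 = x div 3 + 4 * m" unfolding 1(1) by simp
    then have "(x + 12 * m) div 3 mod m = x div 3 mod m" by simp
    moreover have "(x + 12 * m) mod 3 = x mod 3" unfolding 1(1) by (rule mod_mult_self1)
    moreover have "(x + 12 * m) mod 4 = x mod 4" unfolding 1(2) by (rule mod_mult_self1)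
    moreover have "x mod 8 \<noteq> 1" "x mod 8 \<noteq> 5" "(x + 12 * m) mod 8 \<noteq> 1" "(x + 12 * m) mod 8 \<noteq> 5"
      using that by presburger+
    ultimately show ?thesis by (simp only: compl_pred_def)
  qed
  have "even g"
  proof (rule ccontr)
    assume "odd g"
    \<comment> \<open>An odd period would carry this invariance over to the odd point 9, which
      satisfies the predicate while \<open>9 + 12 * m\<close> does not.\<close>
    then have "compl_pred m S (9 + g + 12 * m) = compl_pred m S (9 + g)" by (intro C0) simp
    moreover have "compl_pred m S (9 + g + 12 * m) = compl_pred m S (9 + 12 * m)"
      using per[of "9 + 12 * m"] by (simp add: add_ac)
    ultimately have "compl_pred m S (9 + 12 * m)" using per[of 9] C1[of 9] by simp
    moreover have "(9 + 12 * m) mod 8 = 5" "(9 + 12 * m) mod 3 = 0" using m by presburger+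
    ultimately show False using C1[of "9 + 12 * m"] by simp
  qed
  \<comment> \<open>The points 9 and 13 represent the two columns of the odd part. A period that is
    4 modulo 8 would have to be both 1 and 2 modulo 3.\<close>
  then have "compl_pred m S (9 + g)" "compl_pred m S (13 + g)"
    using per[of 9] per[of 13] C1[of 9] C1[of 13] by simp_all
  then have "((9 + g) mod 8 = 1 \<and> (9 + g) mod 3 = 0 \<or> (9 + g) mod 8 = 5 \<and> (9 + g) mod 3 = 1) \<and>
    ((13 + g) mod 8 = 1 \<and> (13 + g) mod 3 = 0 \<or> (13 + g) mod 8 = 5 \<and> (13 + g) mod 3 = 1)"
    using C1[of "9 + g"] C1[of "13 + g"] \<open>even g\<close> by simp
  moreover have "(9 + g) mod 8 = 1 \<longleftrightarrow> g mod 8 = 0" "(9 + g) mod 8 = 5 \<longleftrightarrow> g mod 8 = 4"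
    "(13 + g) mod 8 = 1 \<longleftrightarrow> g mod 8 = 4" "(13 + g) mod 8 = 5 \<longleftrightarrow> g mod 8 = 0"
    "(9 + g) mod 3 = 0 \<longleftrightarrow> g mod 3 = 0" "(9 + g) mod 3 = 1 \<longleftrightarrow> g mod 3 = 1"
    "(13 + g) mod 3 = 0 \<longleftrightarrow> g mod 3 = 2" "(13 + g) mod 3 = 1 \<longleftrightarrow> g mod 3 = 0"
    by presburger+
  ultimately have "(g mod 8 = 0 \<and> g mod 3 = 0 \<or> g mod 8 = 4 \<and> g mod 3 = 1) \<and>
    (g mod 8 = 4 \<and> g mod 3 = 2 \<or> g mod 8 = 0 \<and> g mod 3 = 0)"
    by (simp only:)
  then have "g mod 8 = 0 \<and> g mod 3 = 0" by (elim conjE disjE) simp_all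
  then have "8 dvd g" "3 dvd g" by (simp_all add: dvd_eq_mod_eq_0)
  then show ?thesis by presburger
qed

text \<open>A test point in row \<open>j\<close>: among the even positions, 2 modulo 4 is reached
  only by slid rows. The point does not depend on \<open>S\<close>, so different complements can be
  compared at it.\<close>

lemma ex_even_row:
  assumes "odd (m::int)"
  obtains x where "\<And>S. compl_pred m S x \<longleftrightarrow> j mod m \<in> S" "x mod 4 = 2" "x mod 3 = 0" "x div 3 mod m = j mod m"
proof -
  obtain x where x: "x mod 8 = 2" "x mod (3 * m) = (3 * j) mod (3 * m)"
    using ex_residues_8_odd[of "3 * m" 2 "3 * j"] assms by auto
  have "3 * m dvd x - 3 * j" using x(2) by (simp only: mod_eq_dvd_iff)
  then obtain q where "x - 3 * j = 3 * m * q" by blast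
  then have "x = 3 * (j + m * q)" by (simp add: algebra_simps)
  then have 1: "x mod 3 = 0" "x div 3 mod m = j mod m" by simp_all
  have 2: "x mod 4 = 2" using x(1) by presburger
  have "compl_pred m S x \<longleftrightarrow> j mod m \<in> S" for S
    using 1 2 x(1) by (simp add: compl_pred_def)
  then show thesis using 2 1 by (rule that)
qed

text \<open>A period has the form \<open>24 * d\<close>; it fixes residues modulo 3 and 4 and moves
  the row index by \<open>8 * d\<close>, which is thus a period of \<open>S\<close>. As
  \<open>m\<close> is odd, the factor 8 cancels.\<close>

lemma not_periodic_compl:
  assumes m: "odd m" "m > 0"
    and S: "\<And>d. (\<And>j. (j + d) mod int m \<in> S \<longleftrightarrow> j mod int m \<in> S) \<Longrightarrow> int m dvd d"
  shows "\<not> periodic (integer_mod_group (24 * m)) (residues_of (24 * m) (compl_pred (int m) S))"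
proof
  assume "periodic (integer_mod_group (24 * m)) (residues_of (24 * m) (compl_pred (int m) S))"
  then obtain g where g: "\<not> int (24 * m) dvd g"
    "\<And>x. compl_pred (int m) S (x + g) = compl_pred (int m) S x"
    by (rule periodic_residues_ofE) (use m in \<open>simp_all add: compl_pred_mod\<close>)
  have 24: "24 dvd g" using compl_period_dvd[OF _ g(2)] m by simp
  then obtain d where d: "g = 24 * d" by blast
  have "(j + 8 * d) mod int m \<in> S \<longleftrightarrow> j mod int m \<in> S" for j
  proof -
    obtain x where x: "\<And>S. compl_pred (int m) S x \<longleftrightarrow> j mod int m \<in> S" "x mod 4 = 2" "x mod 3 = 0"
      "x div 3 mod int m = j mod int m"
      using ex_even_row[of "int m" j] m by auto
    have 1: "x + g = x + (8 * d) * 3" by (simp add: d)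
    have "(x + g) div 3 = x div 3 + 8 * d" unfolding 1 by simp
    then have "(x + g) div 3 mod int m = (j + 8 * d) mod int m"
      using x(4) by (metis mod_add_left_eq)
    moreover have "(x + g) mod 3 = 0" unfolding 1 using x(3) by (simp only: mod_mult_self1)
    moreover have 4: "(x + g) mod 4 = 2"
    proof -
      have "x + g = x + (6 * d) * 4" by (simp add: d)
      then show ?thesis using x(2) by (simp only: mod_mult_self1)
    qed
    moreover have "(x + g) mod 8 \<noteq> 1" "(x + g) mod 8 \<noteq> 5"
      using mod_mod_cancel[of 4 8 "x + g"] 4 by auto
    ultimately have "compl_pred (int m) S (x + g) \<longleftrightarrow> (j + 8 * d) mod int m \<in> S"
      by (simp add: compl_pred_def)
    then show ?thesis using x(1) g(2) by simp
  qed
  then have "int m dvd 8 * d" using S[of "8 * d"] by simp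
  moreover have "coprime (int m) (2 ^ 3)" using m by (subst coprime_power_right_iff) simp
  ultimately have "int m dvd d" using coprime_dvd_mult_right_iff by force
  then show False using g(1) d by auto
qed

section \<open>Distinctness, choice and number of the complements\<close>

lemma inj_compl:
  assumes "odd m" "m > 0"
  shows "inj_on (\<lambda>S. residues_of (24 * m) (compl_pred (int m) S)) (Pow {0..<int m})"
proof (rule inj_onI)
  fix S T
  assume ST: "S \<in> Pow {0..<int m}" "T \<in> Pow {0..<int m}"
    and eq: "residues_of (24 * m) (compl_pred (int m) S) = residues_of (24 * m) (compl_pred (int m) T)"
  have same: "compl_pred (int m) S x = compl_pred (int m) T x" for x
  proof -
    have "x mod int (24 * m) \<in> residues_of (24 * m) (compl_pred (int m) R) \<longleftrightarrow> compl_pred (int m) R x"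
      for R using assms by (simp add: residues_of_def compl_pred_mod)
    then show ?thesis using eq by blast
  qed
  have "j \<in> S \<longleftrightarrow> j \<in> T" if "j \<in> {0..<int m}" for j
  proof -
    obtain x where "\<And>S. compl_pred (int m) S x \<longleftrightarrow> j mod int m \<in> S"
      using ex_even_row[of "int m" j] assms by auto
    then show ?thesis using same[of x] that by simp
  qed
  then show "S = T" using ST by blast
qed

text \<open>Evaluation at 0 and at \<open>- d\<close> puts the residues of \<open>d\<close> and
  \<open>- d\<close> into the set. If nonzero, both exceed \<open>h\<close>, yet they add up to
  \<open>2 * h + 1\<close>.\<close>

lemma period_of_gapped_set:
  assumes T: "T \<subseteq> {int h<..<2 * int h + 1}"
    and per: "\<And>j. (j + d) mod (2 * int h + 1) \<in> insert 0 T \<longleftrightarrow> j mod (2 * int h + 1) \<in> insert 0 T"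
  shows "2 * int h + 1 dvd d"
proof (rule ccontr)
  let ?m = "2 * int h + 1"
  assume "\<not> ?m dvd d"
  then have nz: "d mod ?m \<noteq> 0" by (simp add: dvd_eq_mod_eq_0)
  then have neg: "(- d) mod ?m = ?m - d mod ?m" using zmod_zminus1_eq_if by presburger
  have "d mod ?m \<in> insert 0 T" "(- d) mod ?m \<in> insert 0 T"
    using per[of 0] per[of "- d"] by simp_all
  moreover have "?m - d mod ?m \<noteq> 0" using pos_mod_bound[of ?m d] by simp
  ultimately have "d mod ?m \<in> T" "?m - d mod ?m \<in> T" using nz neg by auto
  then have "int h < d mod ?m" "int h < ?m - d mod ?m" using T by auto
  then show False by simp
qed

text \<open>With so small a constant even the crude bound of a square root by its argument keeps the
  exponent at most \<open>(h - 1) / 2\<close>, and \<open>exp (1/2)\<close> is at most 2.\<close>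

lemma exp_le_two_power:
  assumes "h \<ge> 2"
  shows "exp (1/1000 * sqrt (real (24 * (2 * h + 1)))) \<le> real (2 ^ h - 1)"
proof -
  have "sqrt (real (24 * (2 * h + 1))) \<le> real (24 * (2 * h + 1))"
    by (rule real_le_lsqrt) (simp_all add: power2_eq_square)
  then have "1/1000 * sqrt (real (24 * (2 * h + 1))) \<le> real (h - 1) * (1/2)"
    using assms by (simp add: of_nat_diff field_simps)
  then have "exp (1/1000 * sqrt (real (24 * (2 * h + 1)))) \<le> exp (1/2) ^ (h - 1)"
    unfolding exp_of_nat_mult[symmetric] by simp
  also have "\<dots> \<le> 2 ^ (h - 1)"
    by (intro power_mono) (use exp_bound_half[of "1/2::real"] in simp_all)
  also have "\<dots> \<le> real (2 ^ h - 1)"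
    using assms by (cases h) (simp_all add: of_nat_diff)
  finally show ?thesis .
qed

theorem theorem4p1:
  "\<exists>C::real. C > 0 \<and>
     (\<forall>M::nat. \<exists>N::nat. N > M \<and>
       (\<exists>(A::int set) (B::int set) (k::nat) (Bs::nat \<Rightarrow> int set).
          nonperiodic_tiling (integer_mod_group N) A B \<and>
          inj_on Bs {1..k} \<and>
          (\<forall>i \<in> {1..k}. Bs i \<noteq> B \<and>
             tiling (integer_mod_group N) A (Bs i) \<and>
             \<not> periodic (integer_mod_group N) (Bs i)) \<and>
          real k \<ge> exp (C * sqrt (real N))))"
proof (intro exI[of _ "1/1000"] conjI allI)
  fix M :: nat
  \<comment> \<open>The offset 2 secures \<open>h \<ge> 2\<close> for the exponential
    estimate.\<close>
  define h where "h = M + 2"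
  define m where "m = 2 * h + 1"
  define N where "N = 24 * m"
  define A where "A = residues_of N (box_pred (int m))"
  \<comment> \<open>With 0 inserted by force, \<open>T\<close> ranges freely over subsets of the
    \<open>h\<close>-element set \<open>I\<close>; the empty \<open>T\<close> yields the reference
    complement \<open>B\<close>.\<close>
  define F where "F T = residues_of N (compl_pred (int m) (insert 0 T))" for T
  define I where "I = {int h<..<int m}"
  have m: "odd m" "m > 1" by (simp_all add: m_def h_def)
  have tile: "tiling (integer_mod_group N) A (F T)" for T
    using tiling_box_compl m unfolding A_def F_def N_def by simp
  have nper: "\<not> periodic (integer_mod_group N) (F T)" if "T \<in> Pow I" for T
    unfolding F_def N_def
  proof (rule not_periodic_compl)
    fix d assume "\<And>j. (j + d) mod int m \<in> insert 0 T \<longleftrightarrow> j mod int m \<in> insert 0 T"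
    then show "int m dvd d" using period_of_gapped_set[of T h d] that by (simp add: m_def I_def add_ac)
  qed (use m in auto)
  have inj: "inj_on F (Pow I)"
  proof (rule inj_onI)
    fix S T assume ST: "S \<in> Pow I" "T \<in> Pow I" "F S = F T"
    have sub: "insert 0 R \<in> Pow {0..<int m}" if "R \<in> Pow I" for R
      using that m by (force simp: I_def)
    have "0 < m" using m by simp
    then have "insert 0 S = insert 0 T"
      by (rule inj_onD[OF inj_compl[OF m(1)] _ sub[OF ST(1)] sub[OF ST(2)]])
        (use ST(3) in \<open>simp only: F_def N_def\<close>)
    moreover have "0 \<notin> S" "0 \<notin> T" using ST by (auto simp: I_def)
    ultimately show "S = T" by (metis insert_ident)
  qed
  \<comment> \<open>One of the subsets is spent on \<open>B = F {}\<close>.\<close>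
  define k where "k = (2::nat) ^ h - 1"
  have "card (Pow I - {{}}) = k"
    by (simp add: card_Diff_singleton card_Pow I_def k_def m_def)
  then obtain f where f: "bij_betw f {1..k} (Pow I - {{}})"
    using ex_bij_betw_nat_finite_1[of "Pow I - {{}}"] by (auto simp: I_def)
  have fI: "f i \<in> Pow I" "f i \<noteq> {}" if "i \<in> {1..k}" for i
    using bij_betwE[OF f] that by auto
  have "inj_on (F \<circ> f) {1..k}"
    using f inj by (intro comp_inj_on) (auto simp: bij_betw_def intro: inj_on_subset)
  moreover have "\<forall>i\<in>{1..k}. (F \<circ> f) i \<noteq> F {} \<and> tiling (integer_mod_group N) A ((F \<circ> f) i) \<and>
      \<not> periodic (integer_mod_group N) ((F \<circ> f) i)"
  proof (intro ballI conjI)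
    fix i assume i: "i \<in> {1..k}"
    show "(F \<circ> f) i \<noteq> F {}" using inj_on_eq_iff[OF inj fI(1)[OF i], of "{}"] fI(2)[OF i] by simp
    show "tiling (integer_mod_group N) A ((F \<circ> f) i)" using tile by simp
    show "\<not> periodic (integer_mod_group N) ((F \<circ> f) i)" using nper[OF fI(1)[OF i]] by simp
  qed
  moreover have "nonperiodic_tiling (integer_mod_group N) A (F {})"
    using not_periodic_box[OF m] tile nper[of "{}"] by (simp add: nonperiodic_tiling_def A_def N_def)
  moreover have "real k \<ge> exp (1/1000 * sqrt (real N))"
    using exp_le_two_power[of h] by (simp add: N_def m_def k_def h_def)
  moreover have "N > M" by (simp add: N_def m_def h_def)
  ultimately show "\<exists>N>M. \<exists>A B k Bs. nonperiodic_tiling (integer_mod_group N) A B \<and> inj_on Bs {1..k} \<and>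
      (\<forall>i\<in>{1..k}. Bs i \<noteq> B \<and> tiling (integer_mod_group N) A (Bs i) \<and>
         \<not> periodic (integer_mod_group N) (Bs i)) \<and> exp (1/1000 * sqrt (real N)) \<le> real k"
    by blast
qed simp

end
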